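(* Let $\mathcal{X},\mathcal{Z}$ be finite sets, let $P_{XZ}$ be a probability distribution on $\mathcal{X}\times\mathcal{Z}$, and for each $n\ge1$ let $(X^n,Z^n)=((X_1,Z_1),\dots,(X_n,Z_n))$ be i.i.d. with common distribution $P_{XZ}$. If $\sigma^2=\mathrm{Var}\left[\log\frac{1}{P_{X|Z}(X|Z)}\right]$ is positive, then $$\lim_{n\to\infty}\delta(P_{X^nZ^n})=1 .$$
   Context: Logarithms are natural (base $e$). For probability distributions $P,Q$ on a finite set $\mathcal{A}$, $d(P,Q)=\frac12\sum_{a\in\mathcal{A}}|P(a)-Q(a)|$. Definition of $\delta(P_{X^nZ^n})$: for an integer $1\le M\le|\mathcal{X}|^n$ and a family $\mathcal{C}_n=\{\mathcal{C}_{z^n}\}_{z^n\in\mathcal{Z}^n}$ of subsets $\mathcal{C}_{z^n}\subset\mathcal{X}^n$ with $|\mathcal{C}_{z^n}|=M$ for every $z^n$, let $P_{\mathcal{C}_n}$ be the distribution on $\mathcal{X}^n\times\mathcal{Z}^n$ with $P_{\mathcal{C}_n}(x^n,z^n)=\frac1M P_{Z^n}(z^n)$ if $x^n\in\mathcal{C}_{z^n}$ and $0$ otherwise. Then $\delta(P_{X^nZ^n})=\min_{\mathcal{C}_n}d(P_{X^nZ^n},P_{\mathcal{C}_n})$, where the minimum is over all such families for all integers $1\le M\le|\mathcal{X}|^n$. *)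

theory Defs
  imports "HOL-Probability.Probability"
begin

definition words :: "nat \<Rightarrow> 'a set \<Rightarrow> 'a list set" where
  "words n A = {w. set w \<subseteq> A \<and> length w = n}"

definition total_var :: "'a set \<Rightarrow> ('a \<Rightarrow> real) \<Rightarrow> ('a \<Rightarrow> real) \<Rightarrow> real" where
  "total_var A p q = 1/2 * (\<Sum>a\<in>A. \<bar>p a - q a\<bar>)"

text \<open>The joint law of the pair \<open>(X\<^sup>n, Z\<^sup>n)\<close> of words, where the letters
  \<open>(X\<^sub>i, Z\<^sub>i)\<close> are i.i.d. with law \<open>P\<close>.\<close>

definition iid_words_pmf :: "nat \<Rightarrow> ('x \<times> 'z) pmf \<Rightarrow> ('x list \<times> 'z list) pmf" where
  "iid_words_pmf n P = map_pmf (\<lambda>w. (map fst w, map snd w)) (replicate_pmf n P)"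

definition cond_fst_given_snd :: "('x \<times> 'z) pmf \<Rightarrow> 'x \<Rightarrow> 'z \<Rightarrow> real" where
  "cond_fst_given_snd P x z = pmf P (x, z) / pmf (map_pmf snd P) z"

text \<open>Families of \<open>M\<close>-element subsets of \<open>\<X>\<^sup>n\<close> indexed by \<open>\<Z>\<^sup>n\<close>. The extensional
  function space fixes the value outside \<open>\<Z>\<^sup>n\<close>, so that the set of families is finite.\<close>

definition code_families ::
    "'x set \<Rightarrow> 'z set \<Rightarrow> nat \<Rightarrow> nat \<Rightarrow> ('z list \<Rightarrow> 'x list set) set" where
  "code_families X Z n M = words n Z \<rightarrow>\<^sub>E {S. S \<subseteq> words n X \<and> card S = M}"

definition code_dist ::
    "('x list \<times> 'z list) pmf \<Rightarrow> nat \<Rightarrow> ('z list \<Rightarrow> 'x list set) \<Rightarrow> 'x list \<times> 'z list \<Rightarrow> real" where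
  "code_dist Q M C = (\<lambda>(x, z). if x \<in> C z then 1 / real M * pmf (map_pmf snd Q) z else 0)"

definition delta ::
    "'x set \<Rightarrow> 'z set \<Rightarrow> nat \<Rightarrow> ('x list \<times> 'z list) pmf \<Rightarrow> real" where
  "delta X Z n Q =
     Min {total_var (words n X \<times> words n Z) (pmf Q) (code_dist Q M C) | M C.
            1 \<le> M \<and> M \<le> card X ^ n \<and> C \<in> code_families X Z n M}"

lemma finite_words: "finite A \<Longrightarrow> finite (words n A)"
  unfolding words_def by (rule finite_lists_length_eq)

lemma card_words: "finite A \<Longrightarrow> card (words n A) = card A ^ n"
  unfolding words_def by (rule card_lists_length_eq)

lemma finite_code_families:
  assumes "finite X" and "finite Z"
  shows "finite (code_families X Z n M)"
proof -
  have "finite {S. S \<subseteq> words n X \<and> card S = M}"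
    by (rule finite_subset[of _ "Pow (words n X)"]) (auto simp: finite_words assms(1))
  then show ?thesis
    unfolding code_families_def by (intro finite_PiE finite_words assms(2))
qed

text \<open>The minimum in \<open>delta\<close> ranges over a finite nonempty set.\<close>

lemma delta_Min_wellformed:
  fixes X :: "'x set" and Z :: "'z set"
  assumes "finite X" and "X \<noteq> {}" and "finite Z"
  defines "D \<equiv> \<lambda>n Q. {total_var (words n X \<times> words n Z) (pmf Q) (code_dist Q M C) | M C.
            1 \<le> M \<and> M \<le> card X ^ n \<and> C \<in> code_families X Z n M}"
  shows "finite (D n Q)" and "D n Q \<noteq> {}"
proof -
  have "D n Q = (\<Union>M\<in>{1..card X ^ n}.
      (\<lambda>C. total_var (words n X \<times> words n Z) (pmf Q) (code_dist Q M C)) ` code_families X Z n M)"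
    unfolding D_def by (auto; blast)
  then show "finite (D n Q)"
    using finite_code_families[OF assms(1,3)] by simp
  have "(\<lambda>z\<in>words n Z. words n X) \<in> code_families X Z n (card X ^ n)"
    unfolding code_families_def using card_words[OF assms(1)] by auto
  moreover have "1 \<le> card X ^ n"
    using assms(1,2) by (simp add: Suc_le_eq card_gt_0_iff)
  ultimately show "D n Q \<noteq> {}"
    unfolding D_def by blast
qed

lemma code_dist_nonneg: "0 \<le> code_dist Q M C a"
  unfolding code_dist_def by (auto split: prod.split)

lemma sum_code_dist:
  assumes "finite X" and "finite Z" and "1 \<le> M" and "C \<in> code_families X Z n M"
    and "set_pmf Q \<subseteq> words n X \<times> words n Z"
  shows "(\<Sum>a\<in>words n X \<times> words n Z. code_dist Q M C a) = 1"
proof -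
  have C: "C z \<subseteq> words n X" "card (C z) = M" if "z \<in> words n Z" for z
    using assms(4) that unfolding code_families_def by (auto simp: PiE_iff)
  have inner: "(\<Sum>x\<in>words n X. code_dist Q M C (x, z)) = pmf (map_pmf snd Q) z"
    if z: "z \<in> words n Z" for z
  proof -
    have "(\<Sum>x\<in>words n X. code_dist Q M C (x, z))
        = (\<Sum>x\<in>C z. 1 / real M * pmf (map_pmf snd Q) z)"
      unfolding code_dist_def using C(1)[OF z] finite_words[OF assms(1)]
      by (intro sum.mono_neutral_cong_right) auto
    then show ?thesis
      using C(2)[OF z] assms(3) by simp
  qed
  have "(\<Sum>a\<in>words n X \<times> words n Z. code_dist Q M C a)
      = (\<Sum>z\<in>words n Z. \<Sum>x\<in>words n X. code_dist Q M C (x, z))"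
    using sum.cartesian_product[of "\<lambda>x z. code_dist Q M C (x, z)" "words n Z" "words n X"]
      sum.swap[of "\<lambda>x z. code_dist Q M C (x, z)" "words n Z" "words n X"]
    by simp
  also have "\<dots> = (\<Sum>z\<in>words n Z. pmf (map_pmf snd Q) z)"
    by (rule sum.cong[OF refl inner])
  also have "\<dots> = 1"
    using assms(5) by (intro sum_pmf_eq_1 finite_words assms(2)) auto
  finally show ?thesis .
qed

end

theory Submission
  imports Defs
begin

text \<open>Write \<open>W(x|z)\<close> for the conditional law of \<open>X\<^sup>n\<close> given \<open>Z\<^sup>n\<close>. The distance to a code
  distribution is one minus its overlap with the true law. A code point with \<open>\<bar>ln (1/W(x|z)) - ln M\<bar> \<ge> r\<close>
  carries weights that differ by a factor of at least \<open>e\<^sup>r\<close> under the two laws, so such points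
  contribute at most \<open>2 e\<^sup>-\<^sup>r\<close> to the overlap. The remaining points contribute at most the
  probability that the i.i.d. sum \<open>ln (1/W(X\<^sup>n|Z\<^sup>n))\<close> falls into an interval of length \<open>2 r\<close>. Since
  the variance is positive, the central limit theorem, made uniform over the location of the
  interval, shows that this probability tends to zero however \<open>M\<close> depends on \<open>n\<close>.\<close>

section \<open>Uniform bounds on short intervals under weak convergence\<close>

text \<open>The limit cdf is continuous everywhere, so the cdfs converge at every point of a finite
  grid of spacing \<eta>. An interval of length \<eta> lies in a tail or inside two neighbouring
  grid cells, so finitely many comparisons control all locations \<open>a\<close> at once. Each case
  costs at most three errors of size \<open>e\<close>.\<close>

lemma weak_conv_m_small_intervals:
  assumes conv: "weak_conv_m \<mu> \<nu>" and \<mu>: "\<And>n. real_distribution (\<mu> n)"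
    and \<nu>: "real_distribution \<nu>" and atomless: "\<And>x. measure \<nu> {x} = 0" and "0 < \<epsilon>"
  shows "\<exists>\<eta>>0. \<forall>\<^sub>F n in sequentially. \<forall>a. measure (\<mu> n) {a<..a + \<eta>} < \<epsilon>"
proof -
  interpret \<nu>: real_distribution \<nu> by fact
  define e where "e = \<epsilon> / 3"
  have e: "0 < e" using \<open>0 < \<epsilon>\<close> by (simp add: e_def)
  have cont: "isCont (cdf \<nu>) x" for x
    using atomless by (simp add: \<nu>.isCont_cdf)
  have "\<forall>\<^sub>F k in sequentially. cdf \<nu> (- real k) < e \<and> cdf \<nu> (real k) > 1 - e"
    using order_tendstoD(2)[OF \<nu>.cdf_lim_neg_infty e]
      order_tendstoD(1)[OF \<nu>.cdf_lim_infty_prob, of "1 - e"] e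
    by (simp add: eventually_conj_iff)
  then obtain k where k: "cdf \<nu> (- real k) < e" "cdf \<nu> (real k) > 1 - e"
    by (auto simp: eventually_sequentially)
  define K where "K = real k"
  \<comment> \<open>The margin of 2 on the right leaves room for the grid point two steps beyond a
    point of \<open>[-K, K]\<close>, as \<eta> is at most 1.\<close>
  have "uniformly_continuous_on {-K..K + 2} (cdf \<nu>)"
    by (intro compact_uniformly_continuous continuous_at_imp_continuous_on) (auto simp: cont)
  then obtain d where d: "0 < d" "\<And>x y. x \<in> {-K..K+2} \<Longrightarrow> y \<in> {-K..K+2} \<Longrightarrow>
      dist y x < d \<Longrightarrow> dist (cdf \<nu> y) (cdf \<nu> x) < e"
    using e unfolding uniformly_continuous_on_def by metis
  \<comment> \<open>Two grid steps must stay below the modulus \<open>d\<close>.\<close>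
  define \<eta> where "\<eta> = min 1 (d / 4)"
  have \<eta>: "0 < \<eta>" "\<eta> \<le> 1" "2 * \<eta> < d" using d(1) by (auto simp: \<eta>_def)
  define t where "t j = - K + real j * \<eta>" for j :: nat
  \<comment> \<open>The summand 2 keeps \<open>t (j + 2)\<close> in the grid for every cell index
    \<open>j\<close> that meets \<open>[-K, K]\<close>. The point \<open>K\<close> itself may fall
    between grid points and is added to \<open>T\<close> separately.\<close>
  define N where "N = nat \<lceil>2 * K / \<eta>\<rceil> + 2"
  define T where "T = insert K (t ` {..N})"
  have "\<forall>\<^sub>F n in sequentially. \<forall>x\<in>T. dist (cdf (\<mu> n) x) (cdf \<nu> x) < e"
  proof (rule eventually_ball_finite)
    show "finite T" by (simp add: T_def)
    show "\<forall>x\<in>T. \<forall>\<^sub>F n in sequentially. dist (cdf (\<mu> n) x) (cdf \<nu> x) < e"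
      using conv cont e unfolding weak_conv_m_def weak_conv_def
      by (auto intro: tendstoD)
  qed
  then have "\<forall>\<^sub>F n in sequentially. \<forall>a. measure (\<mu> n) {a<..a + \<eta>} < \<epsilon>"
  proof eventually_elim
    case (elim n)
    interpret n: real_distribution "\<mu> n" by (rule \<mu>)
    have near: "\<bar>cdf (\<mu> n) x - cdf \<nu> x\<bar> < e" if "x \<in> T" for x
      using elim that by (simp add: dist_real_def)
    show ?case
    proof
      fix a
      consider "a < - K" | "K < a" | "- K \<le> a" "a \<le> K" by linarith
      then show "measure (\<mu> n) {a<..a + \<eta>} < \<epsilon>"
      proof cases
        case 1
        have "measure (\<mu> n) {a<..a + \<eta>} \<le> cdf (\<mu> n) (t 1)"
          unfolding cdf_def using 1 by (intro n.finite_measure_mono) (auto simp: t_def)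
        moreover have "\<bar>cdf \<nu> (t 1) - cdf \<nu> (- K)\<bar> < e"
          using d(2)[of "- K" "t 1"] \<eta> by (auto simp: t_def dist_real_def K_def)
        moreover have "t 1 \<in> T" by (auto simp: T_def N_def)
        ultimately show ?thesis
          using near[of "t 1"] k(1) unfolding K_def e_def by linarith
      next
        case 2
        have "measure (\<mu> n) {a<..a + \<eta>} \<le> measure (\<mu> n) {K<..a + \<eta>}"
          using 2 by (intro n.finite_measure_mono) auto
        also have "\<dots> = cdf (\<mu> n) (a + \<eta>) - cdf (\<mu> n) K"
          using 2 \<eta> by (subst n.cdf_diff_eq) auto
        finally have "measure (\<mu> n) {a<..a + \<eta>} \<le> 1 - cdf (\<mu> n) K"
          using n.cdf_bounded_prob[of "a + \<eta>"] by simp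
        moreover have "K \<in> T" by (simp add: T_def)
        ultimately show ?thesis
          using near[of K] k(2) e unfolding K_def e_def by linarith
      next
        case 3
        \<comment> \<open>The cell containing \<open>a\<close>; the interval of length \<eta> that
          starts at \<open>a\<close> ends no later than \<open>t (j + 2)\<close>.\<close>
        define j where "j = nat \<lfloor>(a + K) / \<eta>\<rfloor>"
        have j: "real j \<le> (a + K) / \<eta>" "(a + K) / \<eta> < real j + 1"
          unfolding j_def using 3 \<eta> by simp_all
        have tj: "t j \<le> a" "a < t (j + 1)"
          using j \<eta> by (simp_all add: t_def field_simps)
        have "(a + K) / \<eta> \<le> 2 * K / \<eta>"
          using 3 \<eta> by (intro divide_right_mono) auto
        then have jN: "j + 2 \<le> N"
          unfolding j_def N_def using floor_mono[of "(a + K) / \<eta>" "2 * K / \<eta>"] by linarith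
        have step: "t (j + 1) = t j + \<eta>" "t (j + 2) = t j + 2 * \<eta>"
          by (simp_all add: t_def algebra_simps)
        have "- K \<le> t j" using \<eta> by (simp add: t_def)
        then have "\<bar>cdf \<nu> (t (j + 2)) - cdf \<nu> (t j)\<bar> < e"
          using d(2)[of "t j" "t (j + 2)"] tj 3 \<eta> step by (auto simp: dist_real_def)
        moreover have "measure (\<mu> n) {a<..a + \<eta>} \<le> measure (\<mu> n) {t j<..t (j + 2)}"
          using tj step by (intro n.finite_measure_mono) auto
        moreover have "\<dots> = cdf (\<mu> n) (t (j + 2)) - cdf (\<mu> n) (t j)"
          using step \<eta> by (subst n.cdf_diff_eq) auto
        moreover have "t j \<in> T" "t (j + 2) \<in> T" using jN by (auto simp: T_def)
        ultimately show ?thesis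
          using near[of "t j"] near[of "t (j + 2)"] unfolding e_def by linarith
      qed
    qed
  qed
  with \<eta>(1) show ?thesis by blast
qed

lemma std_normal_distribution_singleton: "measure std_normal_distribution {x} = 0"
proof -
  have "emeasure std_normal_distribution {x} = 0"
    by (subst emeasure_density) (auto simp: nn_integral_0_iff_AE intro!: AE_mp[OF AE_lborel_singleton[of x]])
  then show ?thesis by (simp add: measure_def)
qed

section \<open>Overlap of the true law with a code distribution\<close>

text \<open>Here \<open>q\<close> is the joint mass, \<open>p\<close> the marginal mass of the
  second word and \<open>c\<close> the mass under the code. For a code point,
  \<open>ln (p / q) - ln M\<close> equals \<open>ln (c / q)\<close>, so if it is at least
  \<open>r\<close> in absolute value, one of \<open>q\<close> and \<open>c\<close> is at most
  \<open>exp (- r)\<close> times the other. If \<open>q\<close> or \<open>c\<close> vanishes, so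
  does the minimum.\<close>

lemma min_le_tilted:
  fixes q p c :: real
  assumes "0 \<le> q" "0 \<le> p" "q \<le> p" "c = 0 \<or> c = 1 / real M * p" "1 \<le> M"
  shows "min q c \<le> exp (- r) * (q + c) + (if \<bar>ln (p / q) - ln (real M)\<bar> < r then q else 0)"
proof -
  have c0: "0 \<le> c" using assms by auto
  consider "q = 0" | "0 < q" "\<bar>ln (p / q) - ln (real M)\<bar> < r" | "0 < q" "c = 0"
    | "0 < q" "c = 1 / real M * p" "ln (p / q) - ln (real M) \<ge> r"
    | "0 < q" "c = 1 / real M * p" "ln (p / q) - ln (real M) \<le> - r"
    using assms(1,4) by linarith
  then show ?thesis
  proof cases
    case 2
    then show ?thesis using c0 by (simp add: min_le_iff_disj)
  next
    case 4
    have pos: "0 < p" "0 < c" "0 < real M" using 4 assms by auto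
    have "ln q \<le> ln (exp (- r) * c)"
      using 4 pos by (simp add: ln_mult ln_div)
    then have "q \<le> exp (- r) * c"
      using 4 pos by (subst (asm) ln_le_cancel_iff) auto
    moreover have "0 \<le> exp (- r) * q" using 4 by simp
    ultimately have "min q c \<le> exp (- r) * (q + c)" by (simp add: distrib_left min_le_iff_disj)
    then show ?thesis using 4(1) by auto
  next
    case 5
    have pos: "0 < p" "0 < c" "0 < real M" using 5 assms by auto
    have "ln c \<le> ln (exp (- r) * q)"
      using 5 pos by (simp add: ln_mult ln_div)
    then have "c \<le> exp (- r) * q"
      using 5 pos by (subst (asm) ln_le_cancel_iff) auto
    moreover have "0 \<le> exp (- r) * c" using c0 by simp
    ultimately have "min q c \<le> exp (- r) * (q + c)" by (simp add: distrib_left min_le_iff_disj)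
    then show ?thesis using 5(1) by auto
  qed (use c0 assms in \<open>auto simp: min_def\<close>)
qed

text \<open>The distance is one minus the sum of the pointwise minima. Summing the pointwise bound
  gives \<open>2 * exp (- r)\<close>, because both laws have mass one, plus the probability of the
  exceptional points. The resulting bound depends on the code only through its size
  \<open>M\<close>.\<close>

lemma total_var_code_dist_ge:
  fixes Q :: "('x list \<times> 'z list) pmf"
  assumes "finite X" "finite Z" and M: "1 \<le> M" and C: "C \<in> code_families X Z n M"
    and Q: "set_pmf Q \<subseteq> words n X \<times> words n Z"
  shows "total_var (words n X \<times> words n Z) (pmf Q) (code_dist Q M C) \<ge>
    1 - 2 * exp (- r) - measure_pmf.prob Q {(x, z).
      \<bar>ln (pmf (map_pmf snd Q) z / pmf Q (x, z)) - ln (real M)\<bar> < r}"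
    (is "_ \<ge> 1 - _ - measure_pmf.prob Q ?B")
proof -
  let ?W = "words n X \<times> words n Z" and ?c = "code_dist Q M C"
  have fin: "finite ?W" using assms by (simp add: finite_words)
  have sums: "sum (pmf Q) ?W = 1" "sum ?c ?W = 1"
    using Q fin sum_code_dist[OF assms(1,2) M C Q] by (auto intro: sum_pmf_eq_1)
  have marginal: "pmf Q (x, z) \<le> pmf (map_pmf snd Q) z" for x z
    unfolding pmf_map by (auto simp flip: measure_pmf_single intro!: measure_pmf.finite_measure_mono)
  have B: "(\<Sum>a\<in>?W. if a \<in> ?B then pmf Q a else 0) \<le> measure_pmf.prob Q ?B"
  proof -
    have "(\<Sum>a\<in>?W. if a \<in> ?B then pmf Q a else 0) = measure_pmf.prob Q (?W \<inter> ?B)"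
      using fin by (simp add: measure_measure_pmf_finite sum.inter_restrict)
    also have "\<dots> \<le> measure_pmf.prob Q ?B"
      by (intro measure_pmf.finite_measure_mono) auto
    finally show ?thesis .
  qed
  have "(\<Sum>a\<in>?W. min (pmf Q a) (?c a))
      \<le> (\<Sum>a\<in>?W. exp (- r) * (pmf Q a + ?c a) + (if a \<in> ?B then pmf Q a else 0))"
  proof (rule sum_mono)
    fix a :: "'x list \<times> 'z list"
    obtain x z where a: "a = (x, z)" by (cases a)
    show "min (pmf Q a) (?c a)
        \<le> exp (- r) * (pmf Q a + ?c a) + (if a \<in> ?B then pmf Q a else 0)"
      using min_le_tilted[of "pmf Q (x, z)" "pmf (map_pmf snd Q) z" "?c (x, z)" M r] marginal M
      unfolding a by (auto simp: code_dist_def)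
  qed
  also have "\<dots> \<le> 2 * exp (- r) + measure_pmf.prob Q ?B"
    using B sums by (simp add: sum.distrib flip: sum_distrib_left)
  finally have "(\<Sum>a\<in>?W. min (pmf Q a) (?c a)) \<le> 2 * exp (- r) + measure_pmf.prob Q ?B" .
  moreover have "total_var ?W (pmf Q) ?c = 1 - (\<Sum>a\<in>?W. min (pmf Q a) (?c a))"
  proof -
    have "\<bar>u - v\<bar> = u + v - 2 * min u v" for u v :: real by (auto simp: min_def)
    then show ?thesis
      unfolding total_var_def using sums
      by (simp add: sum.distrib sum_subtractf flip: sum_distrib_left)
  qed
  ultimately show ?thesis by linarith
qed

lemma total_var_code_dist_le_1:
  fixes Q :: "('x list \<times> 'z list) pmf"
  assumes "finite X" "finite Z" "1 \<le> M" "C \<in> code_families X Z n M"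
    "set_pmf Q \<subseteq> words n X \<times> words n Z"
  shows "total_var (words n X \<times> words n Z) (pmf Q) (code_dist Q M C) \<le> 1"
proof -
  let ?W = "words n X \<times> words n Z"
  have "(\<Sum>a\<in>?W. \<bar>pmf Q a - code_dist Q M C a\<bar>) \<le> (\<Sum>a\<in>?W. pmf Q a + code_dist Q M C a)"
    by (intro sum_mono) (simp add: abs_le_iff code_dist_nonneg add_increasing)
  also have "\<dots> = 2"
    using sum_code_dist[OF assms] assms(1,2,5)
    by (simp add: sum.distrib sum_pmf_eq_1 finite_words)
  finally show ?thesis by (simp add: total_var_def)
qed

section \<open>Finite i.i.d. words as initial segments of an infinite i.i.d. sequence\<close>

lemma expectation_pair_pmf_mult:
  fixes g :: "'a \<Rightarrow> complex" and h :: "'b \<Rightarrow> complex"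
  assumes "finite (set_pmf A)" "finite (set_pmf B)"
  shows "measure_pmf.expectation (pair_pmf A B) (\<lambda>(x, y). g x * h y)
    = measure_pmf.expectation A g * measure_pmf.expectation B h"
proof -
  have "measure_pmf.expectation (pair_pmf A B) (\<lambda>(x, y). g x * h y)
      = (\<Sum>(x, y)\<in>set_pmf A \<times> set_pmf B. (pmf A x *\<^sub>R g x) * (pmf B y *\<^sub>R h y))"
    using assms
    by (subst integral_measure_pmf[of "set_pmf A \<times> set_pmf B"])
      (auto intro!: sum.cong simp: pmf_pair mult_ac scaleR_conv_of_real)
  also have "\<dots> = (\<Sum>x\<in>set_pmf A. pmf A x *\<^sub>R g x) * (\<Sum>y\<in>set_pmf B. pmf B y *\<^sub>R h y)"
    by (simp add: sum_product sum.cartesian_product)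
  also have "\<dots> = measure_pmf.expectation A g * measure_pmf.expectation B h"
    using assms by (simp add: integral_measure_pmf[of "set_pmf A"] integral_measure_pmf[of "set_pmf B"])
  finally show ?thesis .
qed

lemma replicate_pmf_Suc_pair:
  "replicate_pmf (Suc n) p = map_pmf (\<lambda>(x, xs). x # xs) (pair_pmf p (replicate_pmf n p))"
  by (simp add: pair_pmf_def map_bind_pmf map_pmf_def bind_assoc_pmf bind_return_pmf)

lemma finite_set_replicate_pmf: "finite (set_pmf p) \<Longrightarrow> finite (set_pmf (replicate_pmf n p))"
  by (simp add: set_replicate_pmf finite_lists_length_eq lists_eq_set)

text \<open>The head of a random word is independent of its tail, so the exponential of the sum
  factors and induction on \<open>n\<close> applies.\<close>

lemma char_sum_list_replicate_pmf:
  fixes f :: "'a \<Rightarrow> real"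
  assumes "finite (set_pmf P)"
  shows "char (distr (replicate_pmf n P) borel (\<lambda>w. sum_list (map f w))) t
    = char (distr P borel f) t ^ n"
proof -
  have "char (distr (replicate_pmf n P) borel (\<lambda>w. sum_list (map f w))) t
    = measure_pmf.expectation (replicate_pmf n P) (\<lambda>w. iexp (t * sum_list (map f w)))"
    by (simp add: char_def integral_distr)
  also have "\<dots> = char (distr P borel f) t ^ n"
  proof (induction n)
    case (Suc n)
    have "measure_pmf.expectation (replicate_pmf (Suc n) P) (\<lambda>w. iexp (t * sum_list (map f w)))
      = measure_pmf.expectation (pair_pmf P (replicate_pmf n P))
          (\<lambda>(x, w). iexp (t * f x) * iexp (t * sum_list (map f w)))"
      unfolding replicate_pmf_Suc_pair
      by (auto simp: distrib_left exp_add case_prod_unfold intro!: Bochner_Integration.integral_cong)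
    also have "\<dots> = char (distr P borel f) t * char (distr P borel f) t ^ n"
      using Suc assms
      by (subst expectation_pair_pmf_mult)
        (auto simp: finite_set_replicate_pmf char_def integral_distr)
    finally show ?case by simp
  qed simp
  finally show ?thesis .
qed

text \<open>The central limit theorem concerns one infinite independent sequence, whereas
  \<open>replicate_pmf n\<close> lives on a different space for each \<open>n\<close>. The
  coordinates of the infinite product supply such a sequence.\<close>

lemma iid_sequence_realization:
  fixes \<mu> :: "real measure"
  assumes "real_distribution \<mu>"
  defines "M \<equiv> PiM (UNIV :: nat set) (\<lambda>_. \<mu>)"
  shows "prob_space M" "prob_space.indep_vars M (\<lambda>_. borel) (\<lambda>i \<omega>. \<omega> i) UNIV"
    "distr M borel (\<lambda>\<omega>. \<omega> i) = \<mu>"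
proof -
  interpret \<mu>: real_distribution \<mu> by fact
  show ps: "prob_space M"
    unfolding M_def by (intro prob_space_PiM) unfold_locales
  have sets: "sets M = sets (PiM UNIV (\<lambda>_. borel))"
    unfolding M_def by (intro sets_PiM_cong) auto
  have marginal: "distr M borel (\<lambda>\<omega>. \<omega> i) = \<mu>" for i
  proof -
    have "distr M borel (\<lambda>\<omega>. \<omega> i) = distr M \<mu> (\<lambda>\<omega>. \<omega> i)"
      by (intro distr_cong) auto
    also have "\<dots> = \<mu>"
      unfolding M_def by (intro distr_PiM_component) (auto intro: \<mu>.prob_space_axioms)
    finally show ?thesis .
  qed
  then show "distr M borel (\<lambda>\<omega>. \<omega> i) = \<mu>" .
  interpret prob_space M by (rule ps)
  have rv: "random_variable borel (\<lambda>\<omega>. \<omega> i)" for i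
    unfolding measurable_cong_sets[OF sets refl] by simp
  \<comment> \<open>Independence amounts to the joint law being the product of the marginals. The
    joint map of the coordinates is the identity, so its law is the product measure itself.\<close>
  have "distr M (PiM UNIV (\<lambda>_. borel)) (\<lambda>\<omega>. \<lambda>i\<in>UNIV. \<omega> i) = distr M M (\<lambda>\<omega>. \<omega>)"
    by (intro distr_cong) (auto simp: sets)
  also have "\<dots> = PiM UNIV (\<lambda>i. distr M borel (\<lambda>\<omega>. \<omega> i))"
    unfolding marginal by (simp add: M_def)
  finally show "indep_vars (\<lambda>_. borel) (\<lambda>i \<omega>. \<omega> i) UNIV"
    by (subst indep_vars_iff_distr_eq_PiM') (auto intro: rv)
qed

text \<open>Both laws have as characteristic function the \<open>n\<close>-th power of that of a
  single letter, so they agree by Levy uniqueness.\<close>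

lemma distr_sum_iid_eq_replicate_pmf:
  fixes f :: "'a \<Rightarrow> real"
  assumes "finite (set_pmf P)"
  defines "M \<equiv> PiM (UNIV :: nat set) (\<lambda>_. distr (measure_pmf P) borel f)"
  shows "distr M borel (\<lambda>\<omega>. \<Sum>i<n. \<omega> i) = distr (replicate_pmf n P) borel (\<lambda>w. sum_list (map f w))"
proof -
  have \<mu>: "real_distribution (distr (measure_pmf P) borel f)"
    by (intro prob_space.real_distribution_distr measure_pmf.prob_space_axioms) simp
  interpret prob_space M
    unfolding M_def using iid_sequence_realization(1)[OF \<mu>] .
  have indep: "indep_vars (\<lambda>_. borel) (\<lambda>i \<omega>. \<omega> i) UNIV"
    unfolding M_def using iid_sequence_realization(2)[OF \<mu>] .
  have rv: "random_variable borel (\<lambda>\<omega>. \<omega> i)" for i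
    using indep by (auto simp: indep_vars_def)
  have "char (distr M borel (\<lambda>\<omega>. \<Sum>i<n. \<omega> i)) t = char (distr P borel f) t ^ n" for t
    using char_distr_sum[OF indep_vars_subset[OF indep, of "{..<n}"], of t]
      iid_sequence_realization(3)[OF \<mu>] by (simp add: M_def)
  then show ?thesis
    by (intro Levy_uniqueness prob_space.real_distribution_distr prob_space_axioms measure_pmf.prob_space_axioms
        borel_measurable_sum rv ext)
      (simp_all add: char_sum_list_replicate_pmf[OF assms(1)])
qed

section \<open>Anticoncentration of i.i.d. sums\<close>

text \<open>Standardizing divides lengths by a scale of order \<open>sqrt n\<close>, so a window of
  fixed width eventually fits into one of length \<eta>, wherever it is centred. The normal limit
  has no atoms, so such windows have small mass uniformly in \<open>a\<close>.\<close>

lemma sum_list_replicate_pmf_anticoncentration: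
  fixes f :: "'a \<Rightarrow> real"
  assumes fin: "finite (set_pmf P)" and var: "0 < measure_pmf.variance P f" and "0 < \<epsilon>"
  shows "\<forall>\<^sub>F n in sequentially. \<forall>a.
    measure_pmf.prob (replicate_pmf n P) {w. \<bar>sum_list (map f w) - a\<bar> < r} < \<epsilon>"
proof -
  define \<mu> where "\<mu> = distr (measure_pmf P) borel f"
  define M where "M = PiM (UNIV :: nat set) (\<lambda>_. \<mu>)"
  define m where "m = measure_pmf.expectation P f"
  define \<sigma> where "\<sigma> = sqrt (measure_pmf.variance P f)"
  have \<mu>: "real_distribution \<mu>"
    unfolding \<mu>_def by (intro prob_space.real_distribution_distr measure_pmf.prob_space_axioms) simp
  interpret prob_space M
    unfolding M_def using iid_sequence_realization(1)[OF \<mu>] .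
  have indep: "indep_vars (\<lambda>_. borel) (\<lambda>i \<omega>. \<omega> i) UNIV"
    unfolding M_def using iid_sequence_realization(2)[OF \<mu>] .
  have marginal: "distr M borel (\<lambda>\<omega>. \<omega> i) = \<mu>" for i
    unfolding M_def using iid_sequence_realization(3)[OF \<mu>] .
  have rv[measurable]: "random_variable borel (\<lambda>\<omega>. \<omega> i)" for i
    using indep by (auto simp: indep_vars_def)
  have transfer: "expectation (\<lambda>\<omega>. g (\<omega> i)) = measure_pmf.expectation P (\<lambda>x. g (f x))"
    if [measurable]: "g \<in> borel_measurable borel" for g :: "real \<Rightarrow> real" and i
    using marginal[of i] integral_distr[OF rv, of g i] integral_distr[of f P borel g]
    by (simp add: \<mu>_def)
  have mean: "expectation (\<lambda>\<omega>. \<omega> i) = m" for i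
    using transfer[of "\<lambda>x. x" i] by (simp add: m_def)
  have \<sigma>: "0 < \<sigma>" "\<sigma>\<^sup>2 = measure_pmf.variance P f"
    using var by (auto simp: \<sigma>_def)
  have variance: "variance (\<lambda>\<omega>. \<omega> i) = \<sigma>\<^sup>2" for i
    using transfer[of "\<lambda>x. (x - m)\<^sup>2" i] by (simp add: mean \<sigma>(2) m_def)
  have "integrable (distr M borel (\<lambda>\<omega>. \<omega> i)) (\<lambda>x. x\<^sup>2)" for i
    unfolding marginal \<mu>_def
    by (subst integrable_distr_eq) (auto intro: integrable_measure_pmf_finite fin)
  then have square_int: "integrable M (\<lambda>\<omega>. (\<omega> i)\<^sup>2)" for i
    by (subst (asm) integrable_distr_eq) auto
  define Y where "Y n \<omega> = (\<Sum>i<n. \<omega> i - m) / sqrt (real n * \<sigma>\<^sup>2)" for n and \<omega> :: "nat \<Rightarrow> real"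
  have Y[measurable]: "random_variable borel (Y n)" for n
    unfolding Y_def by simp
  have "weak_conv_m (\<lambda>n. distr M borel (Y n)) std_normal_distribution"
    unfolding Y_def
    by (rule central_limit_theorem[OF indep mean \<sigma>(1) square_int variance marginal])
  from weak_conv_m_small_intervals[OF this _ real_dist_normal_dist
      std_normal_distribution_singleton \<open>0 < \<epsilon>\<close>]
  obtain \<eta> where \<eta>: "0 < \<eta>"
    and small: "\<forall>\<^sub>F n in sequentially. \<forall>a. measure (distr M borel (Y n)) {a<..a + \<eta>} < \<epsilon>"
    by auto
  have "filterlim (\<lambda>n. sqrt (real n * \<sigma>\<^sup>2)) at_top sequentially"
    using \<sigma>(1)
    by (intro filterlim_compose[OF sqrt_at_top]
        filterlim_at_top_mult_tendsto_pos[OF tendsto_const] filterlim_real_sequentially) auto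
  \<comment> \<open>The bound 1 makes the scale positive, which excludes \<open>n = 0\<close>; the
    other bound makes the rescaled width \<open>2 * r\<close> at most \<eta>.\<close>
  then have "\<forall>\<^sub>F n in sequentially. max 1 (2 * r / \<eta>) \<le> sqrt (real n * \<sigma>\<^sup>2)"
    unfolding filterlim_at_top by blast
  with small show ?thesis
  proof eventually_elim
    case (elim n)
    define s where "s = sqrt (real n * \<sigma>\<^sup>2)"
    have s: "0 < s" "2 * r \<le> \<eta> * s"
      using elim(2) \<eta> by (auto simp: s_def field_simps)
    show ?case
    proof
      fix a
      \<comment> \<open>The image of the left endpoint \<open>a - r\<close> under
        standardization.\<close>
      let ?b = "(a - r - real n * m) / s"
      have "measure_pmf.prob (replicate_pmf n P) {w. \<bar>sum_list (map f w) - a\<bar> < r}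
        = measure (distr (replicate_pmf n P) borel (\<lambda>w. sum_list (map f w))) {x. \<bar>x - a\<bar> < r}"
        by (subst measure_distr) (auto simp: vimage_def)
      also have "\<dots> = prob {\<omega>\<in>space M. \<bar>(\<Sum>i<n. \<omega> i) - a\<bar> < r}"
        unfolding distr_sum_iid_eq_replicate_pmf[OF fin, symmetric] \<mu>_def[symmetric] M_def[symmetric]
        by (subst measure_distr) (auto intro!: arg_cong[where f = prob])
      also have "\<dots> \<le> prob {\<omega>\<in>space M. Y n \<omega> \<in> {?b<..?b + \<eta>}}"
      proof (intro finite_measure_mono)
        show "{\<omega>\<in>space M. \<bar>(\<Sum>i<n. \<omega> i) - a\<bar> < r} \<subseteq> {\<omega>\<in>space M. Y n \<omega> \<in> {?b<..?b + \<eta>}}"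
        proof safe
          fix \<omega>
          assume "\<bar>(\<Sum>i<n. \<omega> i) - a\<bar> < r"
          then have "a - r - real n * m < s * Y n \<omega>" "s * Y n \<omega> \<le> a - r - real n * m + \<eta> * s"
            using s by (auto simp: Y_def s_def[symmetric] sum_subtractf)
          then show "Y n \<omega> \<in> {?b<..?b + \<eta>}"
            using s(1) by (auto simp: field_simps)
        qed
      qed measurable
      also have "\<dots> = measure (distr M borel (Y n)) {?b<..?b + \<eta>}"
        by (subst measure_distr) (auto intro!: arg_cong[where f = prob])
      also have "\<dots> < \<epsilon>" using elim(1) by blast
      finally show "measure_pmf.prob (replicate_pmf n P) {w. \<bar>sum_list (map f w) - a\<bar> < r} < \<epsilon>" .
    qed
  qed
qed

section \<open>The conditional log-likelihood as an i.i.d. sum\<close>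

lemma map_replicate_pmf: "map_pmf (map f) (replicate_pmf n p) = replicate_pmf n (map_pmf f p)"
proof (induction n)
  case (Suc n)
  show ?case
    unfolding replicate_pmf_Suc_pair Suc[symmetric] map_pair[symmetric]
    by (simp add: pmf.map_comp o_def case_prod_unfold)
qed simp

lemma pmf_replicate_pmf: "pmf (replicate_pmf n p) w = (if length w = n then prod_list (map (pmf p) w) else 0)"
proof (induction n arbitrary: w)
  case 0
  then show ?case by (cases w) (auto simp: pmf_return)
next
  case (Suc n)
  show ?case
  proof (cases w)
    case Nil
    then show ?thesis
      by (auto simp: set_replicate_pmf pmf_eq_0_set_pmf)
  next
    case (Cons x xs)
    have "pmf (replicate_pmf (Suc n) p) w = pmf (pair_pmf p (replicate_pmf n p)) (x, xs)"
      unfolding replicate_pmf_Suc_pair Cons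
      using pmf_map_inj'[of "\<lambda>(x, xs). x # xs" "pair_pmf p (replicate_pmf n p)" "(x, xs)"]
      by (simp add: inj_def)
    then show ?thesis using Cons by (simp add: pmf_pair Suc)
  qed
qed

lemma snd_iid_words_pmf: "map_pmf snd (iid_words_pmf n P) = replicate_pmf n (map_pmf snd P)"
  unfolding iid_words_pmf_def map_replicate_pmf[symmetric] by (simp add: pmf.map_comp o_def)

text \<open>Unzipping is injective, with inverse \<open>zip\<close>, so it preserves the mass of
  each point.\<close>

lemma pmf_iid_words_pmf:
  assumes "length w = n"
  shows "pmf (iid_words_pmf n P) (map fst w, map snd w) = prod_list (map (pmf P) w)"
proof -
  have "inj (\<lambda>w :: ('a \<times> 'b) list. (map fst w, map snd w))"
    by (rule inj_on_inverseI[where g = "\<lambda>(x, z). zip x z"]) (simp add: zip_map_fst_snd)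
  from pmf_map_inj'[OF this, of "replicate_pmf n P" w] assms show ?thesis
    by (simp add: iid_words_pmf_def pmf_replicate_pmf)
qed

text \<open>The joint and the marginal mass are both products over the letters, so the logarithm of
  their ratio is a sum. On the support every factor is positive.\<close>

lemma ln_cond_iid_words:
  assumes "w \<in> set_pmf (replicate_pmf n P)"
  shows "ln (pmf (map_pmf snd (iid_words_pmf n P)) (map snd w) / pmf (iid_words_pmf n P) (map fst w, map snd w))
    = sum_list (map (\<lambda>(x, z). ln (1 / cond_fst_given_snd P x z)) w)"
proof -
  have w: "set w \<subseteq> set_pmf P" "length w = n"
    using assms by (auto simp: set_replicate_pmf)
  \<comment> \<open>Positivity of both products is carried through the induction, since the
    logarithm is split only for positive arguments.\<close>
  have "ln (prod_list (map (pmf (map_pmf snd P)) (map snd w)) / prod_list (map (pmf P) w))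
    = sum_list (map (\<lambda>(x, z). ln (1 / cond_fst_given_snd P x z)) w) \<and>
    0 < prod_list (map (pmf (map_pmf snd P)) (map snd w)) \<and> 0 < prod_list (map (pmf P) w)"
    using w(1)
  proof (induction w)
    case (Cons a w)
    have "0 < pmf P a" "0 < pmf (map_pmf snd P) (snd a)"
      using Cons.prems by (auto intro!: pmf_positive)
    with Cons show ?case
      by (auto simp: cond_fst_given_snd_def case_prod_unfold ln_mult ln_div)
  qed simp
  then show ?thesis
    using w(2) by (simp add: snd_iid_words_pmf pmf_iid_words_pmf pmf_replicate_pmf)
qed

section \<open>Convergence of the optimal distance to one\<close>

theorem theorem11:
  fixes X :: "'x set" and Z :: "'z set" and P :: "('x \<times> 'z) pmf"
  assumes "finite X" and "finite Z"
    and "set_pmf P \<subseteq> X \<times> Z"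
    and "measure_pmf.variance P (\<lambda>(x, z). ln (1 / cond_fst_given_snd P x z)) > 0"
  shows "(\<lambda>n. delta X Z n (iid_words_pmf n P)) \<longlonglongrightarrow> 1"
proof (rule tendstoI)
  fix \<epsilon> :: real
  assume \<epsilon>: "0 < \<epsilon>"
  define f where "f = (\<lambda>(x, z). ln (1 / cond_fst_given_snd P x z))"
  \<comment> \<open>Chosen so that \<open>2 * exp (- r)\<close> uses up half of \<epsilon>; the
    anticoncentration bound takes the other half.\<close>
  define r where "r = - ln (\<epsilon> / 4)"
  have r: "2 * exp (- r) = \<epsilon> / 2" using \<epsilon> by (simp add: r_def)
  have fin: "finite (set_pmf P)" using assms by (meson finite_SigmaI finite_subset)
  have "X \<noteq> {}" using assms(3) set_pmf_not_empty[of P] by auto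
  have "\<forall>\<^sub>F n in sequentially. \<forall>a.
      measure_pmf.prob (replicate_pmf n P) {w. \<bar>sum_list (map f w) - a\<bar> < r} < \<epsilon> / 2"
    using assms(4) \<epsilon> by (intro sum_list_replicate_pmf_anticoncentration fin) (auto simp: f_def)
  then show "\<forall>\<^sub>F n in sequentially. dist (delta X Z n (iid_words_pmf n P)) 1 < \<epsilon>"
  proof eventually_elim
    case (elim n)
    let ?Q = "iid_words_pmf n P"
    have Q: "set_pmf ?Q \<subseteq> words n X \<times> words n Z"
      using assms(3) by (fastforce simp: iid_words_pmf_def set_replicate_pmf words_def)
    \<comment> \<open>The minimum is attained by some code, whose size \<open>M\<close> may vary
      with \<open>n\<close> in any way. The anticoncentration bound is uniform in \<open>a\<close>
      and so may be used at \<open>a = ln M\<close>.\<close>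
    have "delta X Z n ?Q \<in> {total_var (words n X \<times> words n Z) (pmf ?Q) (code_dist ?Q M C) | M C.
            1 \<le> M \<and> M \<le> card X ^ n \<and> C \<in> code_families X Z n M}"
      unfolding delta_def
      by (rule Min_in[OF delta_Min_wellformed[OF assms(1) \<open>X \<noteq> {}\<close> assms(2)]])
    then obtain M C where M: "1 \<le> M" and C: "C \<in> code_families X Z n M"
      and \<delta>: "delta X Z n ?Q = total_var (words n X \<times> words n Z) (pmf ?Q) (code_dist ?Q M C)"
      by blast
    \<comment> \<open>The log-likelihood is a sum over letters only on the support, so the two
      events are compared up to words of mass zero.\<close>
    have "measure_pmf.prob ?Q {(x, z). \<bar>ln (pmf (map_pmf snd ?Q) z / pmf ?Q (x, z)) - ln (real M)\<bar> < r}
      = measure_pmf.prob (replicate_pmf n P) {w. \<bar>sum_list (map f w) - ln (real M)\<bar> < r}"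
      unfolding iid_words_pmf_def[of n P, THEN arg_cong, of measure_pmf] measure_map_pmf
      by (intro measure_prob_cong_0)
        (use ln_cond_iid_words in \<open>fastforce simp: f_def pmf_eq_0_set_pmf\<close>)+
    then have "1 - \<epsilon> < delta X Z n ?Q"
      using total_var_code_dist_ge[OF assms(1,2) M C Q, of r] elim[rule_format, of "ln (real M)"] r
      unfolding \<delta> by linarith
    moreover have "delta X Z n ?Q \<le> 1"
      unfolding \<delta> by (rule total_var_code_dist_le_1[OF assms(1,2) M C Q])
    ultimately show "dist (delta X Z n ?Q) 1 < \<epsilon>"
      by (simp add: dist_real_def)
  qed
qed

end
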